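(* Let $Y$ be a real Hilbert space and let $h: Y \to \mathbb{R}\cup\{+\infty\}$ be a closed, proper, convex function. Let $(\lambda_\star^{k+1}, s_\star^{k+1}, \lambda^{k+1}, s^{k+1})_{k\in\mathbb{N}}$ be generated by the inexact proximal point algorithm (IPPA) on $h$ with errors $(\varepsilon_k)_{k\ge 1}$ and step sizes $(\gamma_k)_{k\ge 0}$ satisfying the error and step-size conditions (see context). Let $\bar s = \operatorname{argmin}_{s\in \operatorname{cl}(\operatorname{range}(\partial h))}\|s\|^2$. Then $s_\star^k\to\bar s$ and $s^k\to\bar s$ (in norm). Furthermore, if $h^*(\bar s)<\infty$, then the following rates hold as $N\to\infty$: (a) $\|s_\star^N\|^2-\|\bar s\|^2=O\left(\frac{1}{\sum_{i=0}^{N-1}\gamma_i}\right)$; (b) $\|s^N\|^2-\|\bar s\|^2=O\left(\frac{1}{\sum_{i=0}^{N-1}\gamma_i}\right)$; (c) $\|s_\star^N-\bar s\|=O\left(\frac{1}{\sqrt{\sum_{i=0}^{N-1}\gamma_i}}\right)$; (d) $\|s^N-\bar s\|=O\left(\frac{1}{\sqrt{\sum_{i=0}^{N-1}\gamma_i}}\right)$.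
   Context: Closed means lower semicontinuous. $h^*(s)=\sup_{\lambda\in Y}\langle s,\lambda\rangle - h(\lambda)$ is the convex conjugate, $\partial h$ the subdifferential, $\operatorname{range}(\partial h)=\bigcup_\lambda \partial h(\lambda)$, and $\operatorname{Prox}_{\gamma h}(\lambda)=\operatorname{argmin}_{\mu\in Y}\left(h(\mu)+\tfrac{1}{2\gamma}\|\lambda-\mu\|^2\right)$ for $\gamma>0$. The set $\operatorname{cl}(\operatorname{range}(\partial h))$ is a nonempty closed convex set, so $\bar s$ is its unique element of minimal norm. IPPA on $h$: given $\lambda^0\in Y$, $\gamma_k>0$ ($k\ge 0$) and $\varepsilon_k\ge 0$ ($k\ge 1$), for $k=0,1,2,\dots$: $\lambda_\star^{k+1}=\operatorname{Prox}_{\gamma_k h}(\lambda^k)$; $s_\star^{k+1}=(\lambda^k-\lambda_\star^{k+1})/\gamma_k$; $\lambda^{k+1}\in Y$ is any point with $\|\lambda^{k+1}-\lambda_\star^{k+1}\|\le\varepsilon_{k+1}$; $s^{k+1}=(\lambda^k-\lambda^{k+1})/\gamma_k$. Error and step-size conditions: $\gamma_k>0$, $\varepsilon_k\ge 0$, and (A1) $\sum_{k=1}^\infty\varepsilon_k<\infty$; (A2) $\frac{\varepsilon_{k+1}}{\gamma_k}\sum_{i=0}^k\gamma_i=O\left(\frac{1}{\sqrt{\sum_{i=0}^k\gamma_i}}\right)$; (A3) $\sum_{k=1}^\infty\left((\varepsilon_k/\gamma_k)^2\sum_{i=0}^{k-1}\gamma_i\right)<\infty$; (A4) $\sum_{k=1}^\infty\left((\varepsilon_k/\gamma_k)\sum_{i=1}^{k}\gamma_{i-1}\right)<\infty$;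 (A5) $\sum_{k=0}^\infty\gamma_k=\infty$. *)

theory Defs
  imports "HOL-Analysis.Analysis" "HOL-Library.Landau_Symbols"
begin

text \<open>
  Functions with values in \<open>\<real> \<union> {+\<infinity>}\<close> are functions into \<^typ>\<open>ereal\<close> that avoid \<open>-\<infinity>\<close>;
  this condition is part of \<open>proper_fun\<close>. Real Hilbert spaces are the types of sort
  \<open>{real_inner, complete_space}\<close>.
\<close>

definition proper_fun :: "('a \<Rightarrow> ereal) \<Rightarrow> bool" where
  "proper_fun h \<longleftrightarrow> (\<forall>x. h x \<noteq> -\<infinity>) \<and> (\<exists>x. h x \<noteq> \<infinity>)"

definition closed_fun :: "('a::topological_space \<Rightarrow> ereal) \<Rightarrow> bool" where
  "closed_fun h \<longleftrightarrow> (\<forall>x. h x \<le> Liminf (at x) h)"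

text \<open>
  The library's \<^const>\<open>convex_on\<close> is restricted to real-valued functions. Since
  \<open>0 * \<infinity> = 0\<close> in \<^typ>\<open>ereal\<close>, the inequality is harmless for weights \<open>0\<close> and \<open>1\<close>.
\<close>

definition convex_fun :: "('a::real_vector \<Rightarrow> ereal) \<Rightarrow> bool" where
  "convex_fun h \<longleftrightarrow> (\<forall>x y. \<forall>u\<ge>0. \<forall>v\<ge>0. u + v = 1 \<longrightarrow>
     h (u *\<^sub>R x + v *\<^sub>R y) \<le> ereal u * h x + ereal v * h y)"

definition convex_conjugate :: "('a::real_inner \<Rightarrow> ereal) \<Rightarrow> 'a \<Rightarrow> ereal" where
  "convex_conjugate h s = (SUP x. ereal (s \<bullet> x) - h x)"

text \<open>For proper \<open>h\<close>, the subdifferential is empty at every point where \<open>h\<close> is \<open>+\<infinity>\<close>.\<close>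

definition subdifferential :: "('a::real_inner \<Rightarrow> ereal) \<Rightarrow> 'a \<Rightarrow> 'a set" where
  "subdifferential h x = {s. \<forall>y. h x + ereal (s \<bullet> (y - x)) \<le> h y}"

definition range_subdifferential :: "('a::real_inner \<Rightarrow> ereal) \<Rightarrow> 'a set" where
  "range_subdifferential h = (\<Union>x. subdifferential h x)"

definition prox :: "real \<Rightarrow> ('a::real_inner \<Rightarrow> ereal) \<Rightarrow> 'a \<Rightarrow> 'a" where
  "prox c h x = (ARG_MIN (\<lambda>y. h y + ereal (1 / (2 * c) * (norm (x - y))\<^sup>2)) y. True)"

definition min_norm_subgradient :: "('a::real_inner \<Rightarrow> ereal) \<Rightarrow> 'a" where
  "min_norm_subgradient h = arg_min_on (\<lambda>s. (norm s)\<^sup>2) (closure (range_subdifferential h))"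

text \<open>
  The sequences \<open>\<epsilon>\<close>, \<open>lstar\<close>, \<open>sstar\<close>, \<open>s\<close> start at index \<open>1\<close>; their value at index \<open>0\<close> is unconstrained.
\<close>

definition ippa ::
  "('a::real_inner \<Rightarrow> ereal) \<Rightarrow> (nat \<Rightarrow> real) \<Rightarrow> (nat \<Rightarrow> real) \<Rightarrow>
   (nat \<Rightarrow> 'a) \<Rightarrow> (nat \<Rightarrow> 'a) \<Rightarrow> (nat \<Rightarrow> 'a) \<Rightarrow> (nat \<Rightarrow> 'a) \<Rightarrow> bool" where
  "ippa h \<gamma> \<epsilon> lstar sstar l s \<longleftrightarrow> (\<forall>k.
     lstar (Suc k) = prox (\<gamma> k) h (l k) \<and>
     sstar (Suc k) = (l k - lstar (Suc k)) /\<^sub>R \<gamma> k \<and>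
     norm (l (Suc k) - lstar (Suc k)) \<le> \<epsilon> (Suc k) \<and>
     s (Suc k) = (l k - l (Suc k)) /\<^sub>R \<gamma> k)"

definition error_step_conditions :: "(nat \<Rightarrow> real) \<Rightarrow> (nat \<Rightarrow> real) \<Rightarrow> bool" where
  "error_step_conditions \<gamma> \<epsilon> \<longleftrightarrow>
     (\<forall>k. \<gamma> k > 0) \<and> (\<forall>k\<ge>1. \<epsilon> k \<ge> 0) \<and>
     summable (\<lambda>k. \<epsilon> (Suc k)) \<and>
     (\<lambda>k. \<epsilon> (Suc k) / \<gamma> k * (\<Sum>i\<le>k. \<gamma> i)) \<in> O(\<lambda>k. 1 / sqrt (\<Sum>i\<le>k. \<gamma> i)) \<and>
     summable (\<lambda>k. (\<epsilon> (Suc k) / \<gamma> (Suc k))\<^sup>2 * (\<Sum>i<Suc k. \<gamma> i)) \<and>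
     summable (\<lambda>k. \<epsilon> (Suc k) / \<gamma> (Suc k) * (\<Sum>i=1..Suc k. \<gamma> (i - 1))) \<and>
     filterlim (\<lambda>n. \<Sum>k<n. \<gamma> k) at_top sequentially"

end

theory Submission
  imports Defs
begin

text \<open>
  Write \<open>T N\<close> for the sum of the first \<open>N\<close> step sizes. Summing the subgradient inequalities and the
  monotonicity of the subdifferential along the iteration bounds
  \<open>(T N)\<^sup>2 * (norm (sstar N))\<^sup>2 + 2 * T N * (h (lstar N) - h u) + (norm (lstar N - u))\<^sup>2\<close> by \<open>O(T N)\<close> for
  every \<open>u\<close> with \<open>h u < \<infinity>\<close>. If \<open>h\<close> has an affine minorant of slope \<open>w\<close>, completing the square in
  \<open>lstar N - u\<close> turns this into \<open>(norm (sstar N))\<^sup>2 \<le> (norm w)\<^sup>2 + O(1 / T N)\<close>. The slopes of affine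
  minorants form the domain of the conjugate, a convex set with the same closure as the range of the
  subdifferential, so slopes \<open>w\<close> close to the minimal norm element \<open>sbar\<close> give convergence and
  \<open>w = sbar\<close> gives the rates, by way of
  \<open>(norm (sstar N - sbar))\<^sup>2 \<le> (norm (sstar N))\<^sup>2 - (norm sbar)\<^sup>2\<close>.
\<close>

section \<open>Extended-valued convex functions and a lower bound of norm type\<close>

lemma proper_fun_ereal:
  assumes "proper_fun h" and "h x < \<infinity>"
  shows "h x = ereal (real_of_ereal (h x))"
  using assms by (cases "h x") (auto simp: proper_fun_def)

lemma closed_fun_eventually_greater:
  assumes "closed_fun h" and "a < h x"
  shows "\<forall>\<^sub>F y in nhds x. a < h y"
  using assms unfolding closed_fun_def eventually_nhds_conv_at by (simp add: le_Liminf_iff)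

lemma convex_fun_segment:
  assumes "convex_fun h" and "h x = ereal a" and "h y = ereal b" and "0 \<le> t" and "t \<le> 1"
  shows "h (x + t *\<^sub>R (y - x)) \<le> ereal (a + t * (b - a))"
proof -
  have "h ((1 - t) *\<^sub>R x + t *\<^sub>R y) \<le> ereal (1 - t) * h x + ereal t * h y"
    using assms(1,4,5) unfolding convex_fun_def by simp
  moreover have "(1 - t) *\<^sub>R x + t *\<^sub>R y = x + t *\<^sub>R (y - x)" by (simp add: algebra_simps)
  ultimately show ?thesis using assms(2,3) by (simp add: algebra_simps)
qed

text \<open>
  Lower semicontinuity bounds \<open>h\<close> below on a small ball, and convexity extends this bound along rays;
  this replaces the Hahn-Banach theorem.
\<close>

lemma closed_convex_norm_minorant:
  fixes h :: "'a::real_normed_vector \<Rightarrow> ereal"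
  assumes "closed_fun h" and "proper_fun h" and "convex_fun h"
  obtains a b x0 where "\<And>y. ereal (a - b * norm (y - x0)) \<le> h y"
proof -
  obtain x0 where x0: "h x0 < \<infinity>" using assms(2) by (auto simp: proper_fun_def)
  define c where "c = real_of_ereal (h x0)"
  have c: "h x0 = ereal c" using proper_fun_ereal[of h, OF assms(2) x0] by (simp add: c_def)
  have "\<forall>\<^sub>F y in nhds x0. ereal (c - 1) < h y"
    by (rule closed_fun_eventually_greater[OF assms(1)]) (simp add: c)
  then obtain d where d: "d > 0" "\<And>y. dist y x0 < d \<Longrightarrow> ereal (c - 1) < h y"
    by (auto simp: eventually_nhds_metric)
  have "ereal (c - 1 - 2 / d * norm (y - x0)) \<le> h y" for y
  proof (cases "norm (y - x0) < d \<or> h y = \<infinity>")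
    case True
    have "ereal (c - 1 - 2 / d * norm (y - x0)) \<le> ereal (c - 1)" using d(1) by simp
    also have "\<dots> \<le> h y" using True d(2)[of y] by (auto simp: dist_norm)
    finally show ?thesis .
  next
    case False
    define v where "v = real_of_ereal (h y)"
    have v: "h y = ereal v" using proper_fun_ereal[of h y] assms(2) False by (auto simp: v_def)
    \<comment> \<open>This puts the point of the segment at distance \<open>d / 2\<close> from
      \<open>x0\<close>, inside the ball where \<open>c - 1\<close> is a lower bound;
      \<open>norm (y - x0) \<ge> d\<close> keeps \<open>t\<close> below 1.\<close>
    define t where "t = d / (2 * norm (y - x0))"
    have pos: "norm (y - x0) > 0" using False d(1) by linarith
    have t: "0 < t" "t \<le> 1" using False d(1) pos by (auto simp: t_def field_simps)
    have "dist (x0 + t *\<^sub>R (y - x0)) x0 < d" using t pos d(1) by (simp add: dist_norm t_def)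
    then have "ereal (c - 1) < ereal (c + t * (v - c))"
      using d(2) convex_fun_segment[OF assms(3) c v, of t] t by (meson less_imp_le order_less_le_trans)
    then have "- 1 < t * (v - c)" by simp
    then have "c - 1 / t < v" using t by (simp add: field_simps)
    moreover have "1 / t = 2 / d * norm (y - x0)" by (simp add: t_def)
    ultimately show ?thesis by (simp add: v)
  qed
  then show ?thesis using that by blast
qed

section \<open>Existence of proximal points and their subgradients\<close>

text \<open>The parallelogram law, arranged to show the gain of the squared norm at a
  midpoint.\<close>

lemma norm_midpoint_sq:
  fixes u v :: "'a::real_inner"
  shows "(norm (u + (1/2) *\<^sub>R (v - u)))\<^sup>2 = ((norm u)\<^sup>2 + (norm v)\<^sup>2) / 2 - (norm (u - v))\<^sup>2 / 4"
  by (simp add: power2_norm_eq_inner inner_simps inner_commute field_simps)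

lemma norm_diff_scaleR_sq:
  fixes u v :: "'a::real_inner"
  shows "(norm (u - t *\<^sub>R v))\<^sup>2 = (norm u)\<^sup>2 - 2 * t * (u \<bullet> v) + t\<^sup>2 * (norm v)\<^sup>2"
  unfolding power2_norm_eq_inner
  by (simp add: inner_simps inner_commute power2_eq_square algebra_simps)

text \<open>Direct method: the quadratic term dominates the norm minorant, so the infimum is finite;
  strong convexity makes a minimising sequence Cauchy; completeness and lower semicontinuity show
  that its limit is a minimiser.\<close>

lemma prox_minimiser_exists:
  fixes h :: "'a::{real_inner, complete_space} \<Rightarrow> ereal"
  assumes cl: "closed_fun h" and pr: "proper_fun h" and co: "convex_fun h" and c: "c > 0"
  obtains z where "h z < \<infinity>"
    and "\<And>y. h z + ereal (c * (norm (x - z))\<^sup>2) \<le> h y + ereal (c * (norm (x - y))\<^sup>2)"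
proof -
  define f where "f y = real_of_ereal (h y)" for y
  define S where "S = {y. h y < \<infinity>}"
  have hf: "h y = ereal (f y)" if "y \<in> S" for y
    using proper_fun_ereal[OF pr] that by (auto simp: f_def S_def)
  have S: "S \<noteq> {}" using pr by (auto simp: proper_fun_def S_def)
  define \<phi> where "\<phi> y = f y + c * (norm (x - y))\<^sup>2" for y
  obtain a b x0 where minor: "\<And>y. ereal (a - b * norm (y - x0)) \<le> h y"
    using closed_convex_norm_minorant[OF cl pr co] by blast
  have bdd: "bdd_below (\<phi> ` S)"
  proof (intro bdd_belowI2)
    fix y assume y: "y \<in> S"
    define r where "r = norm (x - y)"
    have "norm (y - x0) \<le> norm (x - x0) + r"
      using norm_triangle_ineq4[of "x - x0" "x - y"] by (simp add: r_def)
    then have "\<bar>b\<bar> * norm (y - x0) \<le> \<bar>b\<bar> * (norm (x - x0) + r)" by (intro mult_left_mono) auto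
    moreover have "b * norm (y - x0) \<le> \<bar>b\<bar> * norm (y - x0)" by (intro mult_right_mono) auto
    moreover have "a - b * norm (y - x0) \<le> f y" using minor[of y] hf[OF y] by simp
    \<comment> \<open>Completing the square absorbs the linear decay of the minorant into the
      quadratic term.\<close>
    moreover have "\<bar>b\<bar> * r \<le> c * r\<^sup>2 + b\<^sup>2 / (4 * c)"
    proof -
      have "0 \<le> c * (r - \<bar>b\<bar> / (2 * c))\<^sup>2" using c by simp
      also have "\<dots> = c * r\<^sup>2 + b\<^sup>2 / (4 * c) - \<bar>b\<bar> * r"
        using c by (simp add: power2_diff power_divide field_simps) (simp add: power2_eq_square)
      finally show ?thesis by simp
    qed
    ultimately show "a - \<bar>b\<bar> * norm (x - x0) - b\<^sup>2 / (4 * c) \<le> \<phi> y"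
      by (simp add: \<phi>_def r_def algebra_simps)
  qed
  define m where "m = Inf (\<phi> ` S)"
  have m_le: "m \<le> \<phi> y" if "y \<in> S" for y using bdd that by (auto simp: m_def intro: cINF_lower)
  have "\<exists>y\<in>S. \<phi> y < m + inverse (real (Suc n))" for n
  proof -
    have "Inf (\<phi> ` S) < m + inverse (real (Suc n))" unfolding m_def by simp
    then show ?thesis using cInf_less_iff[of "\<phi> ` S"] S bdd by auto
  qed
  then obtain y where y: "\<And>n. y n \<in> S" "\<And>n. \<phi> (y n) < m + inverse (real (Suc n))" by metis
  \<comment> \<open>The midpoint of two near-minimisers cannot have a value below \<open>m\<close>,
    so the gain from the parallelogram law is at most their mean excess over
    \<open>m\<close>.\<close>
  have mid: "c / 4 * (norm (y i - y j))\<^sup>2 \<le> (inverse (real (Suc i)) + inverse (real (Suc j))) / 2" for i j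
  proof -
    define z where "z = y i + (1/2) *\<^sub>R (y j - y i)"
    have hz: "h z \<le> ereal (f (y i) + 1/2 * (f (y j) - f (y i)))"
      unfolding z_def using convex_fun_segment[OF co hf[OF y(1)] hf[OF y(1)], of "1/2" i j] by simp
    then have zS: "z \<in> S" by (auto simp: S_def)
    have "f z \<le> f (y i) + 1/2 * (f (y j) - f (y i))" using hz hf[OF zS] by simp
    moreover have "(norm (x - z))\<^sup>2 =
        ((norm (x - y i))\<^sup>2 + (norm (x - y j))\<^sup>2) / 2 - (norm (y i - y j))\<^sup>2 / 4"
      using norm_midpoint_sq[of "x - y i" "x - y j"]
      by (simp add: z_def algebra_simps norm_minus_commute)
    then have "c * (norm (x - z))\<^sup>2 =
        (c * (norm (x - y i))\<^sup>2 + c * (norm (x - y j))\<^sup>2) / 2 - c / 4 * (norm (y i - y j))\<^sup>2"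
      by (simp only:) (simp add: field_simps)
    ultimately have "\<phi> z \<le> (\<phi> (y i) + \<phi> (y j)) / 2 - c / 4 * (norm (y i - y j))\<^sup>2"
      unfolding \<phi>_def by argo
    with m_le[OF zS] y(2)[of i] y(2)[of j] show ?thesis by argo
  qed
  have "Cauchy y"
  proof (rule metric_CauchyI)
    fix e :: real assume e: "e > 0"
    define q where "q = c * e\<^sup>2 / 4"
    have "q > 0" using c e by (simp add: q_def)
    then obtain M where M: "inverse (real (Suc M)) < q" using reals_Archimedean by blast
    show "\<exists>M. \<forall>i\<ge>M. \<forall>j\<ge>M. dist (y i) (y j) < e"
    proof (intro exI allI impI)
      fix i j assume "i \<ge> M" "j \<ge> M"
      then have "inverse (real (Suc i)) \<le> inverse (real (Suc M))"
        "inverse (real (Suc j)) \<le> inverse (real (Suc M))" by (simp_all add: divide_simps)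
      then have "c / 4 * (norm (y i - y j))\<^sup>2 < q" using mid[of i j] M by argo
      then have "(norm (y i - y j))\<^sup>2 < e\<^sup>2" using c by (simp add: q_def field_simps)
      then show "dist (y i) (y j) < e" using e by (simp add: dist_norm power2_less_imp_less)
    qed
  qed
  then obtain z where z: "y \<longlonglongrightarrow> z" by (auto simp: Cauchy_convergent_iff convergent_def)
  \<comment> \<open>If this failed, some \<open>q\<close> strictly between the two sides would
    eventually lie below \<open>h (y n)\<close>, which itself is bounded by a sequence tending to
    the right-hand side.\<close>
  have hz: "h z \<le> ereal (m - c * (norm (x - z))\<^sup>2)"
  proof (rule ccontr)
    assume "\<not> ?thesis"
    then have "ereal (m - c * (norm (x - z))\<^sup>2) < h z" by simp
    then obtain q where q: "ereal (m - c * (norm (x - z))\<^sup>2) < ereal q" "ereal q < h z"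
      using ereal_dense2 by blast
    have "\<forall>\<^sub>F n in sequentially. ereal q < h (y n)"
      using closed_fun_eventually_greater[OF cl q(2)] z by (rule eventually_compose_filterlim)
    then have "\<forall>\<^sub>F n in sequentially. q \<le> m + inverse (real (Suc n)) - c * (norm (x - y n))\<^sup>2"
    proof eventually_elim
      case (elim n)
      then show ?case using y(2)[of n] hf[OF y(1), of n] by (simp add: \<phi>_def)
    qed
    moreover have "(\<lambda>n. m + inverse (real (Suc n)) - c * (norm (x - y n))\<^sup>2)
        \<longlonglongrightarrow> m + 0 - c * (norm (x - z))\<^sup>2"
      by (intro tendsto_intros z LIMSEQ_inverse_real_of_nat)
    ultimately have "q \<le> m + 0 - c * (norm (x - z))\<^sup>2"
      by (intro tendsto_lowerbound) auto
    with q(1) show False by simp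
  qed
  show thesis
  proof (rule that)
    show "h z < \<infinity>" using hz by auto
    fix w
    show "h z + ereal (c * (norm (x - z))\<^sup>2) \<le> h w + ereal (c * (norm (x - w))\<^sup>2)"
    proof (cases "w \<in> S")
      case True
      have "z \<in> S" using hz by (auto simp: S_def)
      then show ?thesis using m_le[OF True] hz hf[OF True] hf[of z] by (simp add: \<phi>_def)
    qed (auto simp: S_def)
  qed
qed

lemma subdifferential_finite:
  assumes "proper_fun h" and "s \<in> subdifferential h x"
  shows "h x < \<infinity>"
proof (rule ccontr)
  assume "\<not> ?thesis"
  with assms(2) have "h y = \<infinity>" for y by (auto simp: subdifferential_def dest!: spec[of _ y])
  then show False using assms(1) by (auto simp: proper_fun_def)
qed

text \<open>This is the optimality condition of the proximal problem, obtained by varying the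
  minimiser \<open>z\<close> along the segment towards \<open>y\<close> and letting the parameter
  tend to 0.\<close>

lemma prox_subgradient:
  fixes h :: "'a::{real_inner, complete_space} \<Rightarrow> ereal"
  assumes cl: "closed_fun h" and pr: "proper_fun h" and co: "convex_fun h" and \<gamma>: "\<gamma> > 0"
  shows "(x - prox \<gamma> h x) /\<^sub>R \<gamma> \<in> subdifferential h (prox \<gamma> h x)"
proof -
  define c where "c = 1 / (2 * \<gamma>)"
  have c: "c > 0" using \<gamma> by (simp add: c_def)
  define z where "z = prox \<gamma> h x"
  obtain z0 where z0: "h z0 < \<infinity>"
    "\<And>y. h z0 + ereal (c * (norm (x - z0))\<^sup>2) \<le> h y + ereal (c * (norm (x - y))\<^sup>2)"
    using prox_minimiser_exists[OF cl pr co c] by blast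
  then have "is_arg_min (\<lambda>y. h y + ereal (c * (norm (x - y))\<^sup>2)) (\<lambda>_. True) z0"
    by (simp add: is_arg_min_linorder)
  \<comment> \<open>\<open>prox\<close> is a Hilbert choice among minimisers, so the existence of
    \<open>z0\<close> makes the chosen point a minimiser.\<close>
  then have "is_arg_min (\<lambda>y. h y + ereal (c * (norm (x - y))\<^sup>2)) (\<lambda>_. True) z"
    unfolding z_def prox_def arg_min_def c_def[symmetric] by (rule someI)
  then have min: "h z + ereal (c * (norm (x - z))\<^sup>2) \<le> h y + ereal (c * (norm (x - y))\<^sup>2)" for y
    by (simp add: is_arg_min_linorder)
  have "h z < \<infinity>" using min[of z0] z0(1) by (cases "h z0"; cases "h z") auto
  then obtain a where a: "h z = ereal a" using proper_fun_ereal[OF pr] by blast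
  have "h z + ereal (((x - z) /\<^sub>R \<gamma>) \<bullet> (y - z)) \<le> h y" for y
  proof (cases "h y < \<infinity>")
    case True
    then obtain b where b: "h y = ereal b" using proper_fun_ereal[OF pr] by blast
    define q where "q = (x - z) \<bullet> (y - z)"
    define r where "r = (norm (y - z))\<^sup>2"
    \<comment> \<open>After division by \<open>t\<close>, convexity contributes \<open>b - a\<close>
      and the quadratic term contributes \<open>2 * c * q\<close> with a remainder of order
      \<open>t\<close>.\<close>
    have ineq: "2 * c * q \<le> b - a + t * (c * r)" if t: "0 < t" "t \<le> 1" for t
    proof -
      define w where "w = z + t *\<^sub>R (y - z)"
      have "h w \<le> ereal (a + t * (b - a))"
        unfolding w_def using convex_fun_segment[OF co a b] t by simp
      have "ereal (a + c * (norm (x - z))\<^sup>2) \<le> h w + ereal (c * (norm (x - w))\<^sup>2)"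
        using min[of w] a by simp
      also have "\<dots> \<le> ereal (a + t * (b - a)) + ereal (c * (norm (x - w))\<^sup>2)"
        by (rule add_right_mono) fact
      finally have "a + c * (norm (x - z))\<^sup>2 \<le> a + t * (b - a) + c * (norm (x - w))\<^sup>2" by simp
      moreover have "(norm (x - w))\<^sup>2 = (norm (x - z))\<^sup>2 - 2 * t * q + t\<^sup>2 * r"
        using norm_diff_scaleR_sq[of "x - z" t "y - z"] by (simp add: w_def q_def r_def algebra_simps)
      ultimately have "c * (norm (x - z))\<^sup>2 \<le> t * (b - a) + c * ((norm (x - z))\<^sup>2 - 2 * t * q + t\<^sup>2 * r)"
        by simp
      then have "t * (2 * c * q) \<le> t * (b - a + t * (c * r))"
        by (simp add: algebra_simps power2_eq_square)
      then show ?thesis using t by simp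
    qed
    have "((\<lambda>t. b - a + t * (c * r)) \<longlongrightarrow> b - a + 0 * (c * r)) (at_right 0)"
      by (intro tendsto_intros)
    moreover have "\<forall>\<^sub>F t in at_right 0. 2 * c * q \<le> b - a + t * (c * r)"
      unfolding eventually_at_right_field by (intro exI[of _ 1]) (auto intro!: ineq)
    ultimately have "2 * c * q \<le> b - a + 0 * (c * r)" by (intro tendsto_lowerbound) auto
    moreover have "((x - z) /\<^sub>R \<gamma>) \<bullet> (y - z) = 2 * c * q"
      unfolding inner_scaleR_left c_def q_def using \<gamma> by (simp add: field_simps)
    ultimately show ?thesis using a b by simp
  qed simp
  then show ?thesis unfolding subdifferential_def z_def by simp
qed

section \<open>Slopes of affine minorants and the range of the subdifferential\<close>

text \<open>The domain of the conjugate without subtraction in \<open>ereal\<close>: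
  \<open>K\<close> is a real upper bound of \<open>convex_conjugate h s\<close>.\<close>

definition affine_minorant_slopes :: "('a::real_inner \<Rightarrow> ereal) \<Rightarrow> 'a set" where
  "affine_minorant_slopes h = {s. \<exists>K. \<forall>y. ereal (s \<bullet> y - K) \<le> h y}"

lemma convex_affine_minorant_slopes: "convex (affine_minorant_slopes h)"
proof (rule convexI)
  fix s s' :: 'a and u v :: real
  assume "s \<in> affine_minorant_slopes h" "s' \<in> affine_minorant_slopes h"
    and uv: "0 \<le> u" "0 \<le> v" "u + v = 1"
  then obtain K K' where K: "\<And>y. ereal (s \<bullet> y - K) \<le> h y" "\<And>y. ereal (s' \<bullet> y - K') \<le> h y"
    unfolding affine_minorant_slopes_def by blast
  have "ereal ((u *\<^sub>R s + v *\<^sub>R s') \<bullet> y - (u * K + v * K')) \<le> h y" for y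
  proof -
    have "(u *\<^sub>R s + v *\<^sub>R s') \<bullet> y - (u * K + v * K') = u * (s \<bullet> y - K) + v * (s' \<bullet> y - K')"
      by (simp add: inner_simps algebra_simps)
    \<comment> \<open>Passing through the maximum keeps the convex combination among real numbers,
      while \<open>h y\<close> may be infinite.\<close>
    also have "\<dots> \<le> max (s \<bullet> y - K) (s' \<bullet> y - K')"
      using convex_bound_le[of _ "max (s \<bullet> y - K) (s' \<bullet> y - K')"] uv by simp
    finally have "ereal ((u *\<^sub>R s + v *\<^sub>R s') \<bullet> y - (u * K + v * K'))
        \<le> ereal (max (s \<bullet> y - K) (s' \<bullet> y - K'))" by (simp only: ereal_less_eq)
    also have "\<dots> \<le> h y" using K[of y] by (simp add: max_def)
    finally show ?thesis .
  qed
  then show "u *\<^sub>R s + v *\<^sub>R s' \<in> affine_minorant_slopes h"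
    unfolding affine_minorant_slopes_def by blast
qed

lemma range_subdifferential_subset_slopes:
  assumes "proper_fun h"
  shows "range_subdifferential h \<subseteq> affine_minorant_slopes h"
proof
  fix s assume "s \<in> range_subdifferential h"
  then obtain x where s: "s \<in> subdifferential h x" by (auto simp: range_subdifferential_def)
  obtain a where a: "h x = ereal a"
    using proper_fun_ereal[OF assms subdifferential_finite[OF assms s]] by blast
  have "ereal (s \<bullet> y - (s \<bullet> x - a)) \<le> h y" for y
  proof -
    have "ereal (a + s \<bullet> (y - x)) \<le> h y" using s a by (auto simp: subdifferential_def)
    then show ?thesis by (simp add: inner_simps algebra_simps)
  qed
  then show "s \<in> affine_minorant_slopes h" unfolding affine_minorant_slopes_def by blast
qed

text \<open>
  For \<open>p = prox T h (u + T *\<^sub>R s)\<close> and \<open>g = (u + T *\<^sub>R s - p) /\<^sub>R T\<close> one has \<open>p - u = T *\<^sub>R (s - g)\<close>, so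
  the two lower bounds with slopes \<open>g\<close> and \<open>s\<close> give \<open>T * (norm (s - g))\<^sup>2 \<le> h u + K - s \<bullet> u\<close>.
\<close>

lemma slopes_subset_closure_range_subdifferential:
  fixes h :: "'a::{real_inner, complete_space} \<Rightarrow> ereal"
  assumes cl: "closed_fun h" and pr: "proper_fun h" and co: "convex_fun h"
  shows "affine_minorant_slopes h \<subseteq> closure (range_subdifferential h)"
proof
  fix s assume "s \<in> affine_minorant_slopes h"
  then obtain K where K: "\<And>y. ereal (s \<bullet> y - K) \<le> h y" unfolding affine_minorant_slopes_def by blast
  obtain u where u: "h u < \<infinity>" using pr by (auto simp: proper_fun_def)
  obtain a where a: "h u = ereal a" using proper_fun_ereal[OF pr u] by blast
  define D where "D = a + K - s \<bullet> u"
  have D: "D \<ge> 0" using K[of u] a by (simp add: D_def)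
  show "s \<in> closure (range_subdifferential h)"
    unfolding closure_approachable
  proof (intro allI impI)
    fix e :: real assume e: "e > 0"
    \<comment> \<open>Chosen so that \<open>D < T * e\<^sup>2\<close>, also when \<open>D\<close> is
      0.\<close>
    define T where "T = (D + 1) / e\<^sup>2"
    have T: "T > 0" using D e by (simp add: T_def)
    define p where "p = prox T h (u + T *\<^sub>R s)"
    define g where "g = (u + T *\<^sub>R s - p) /\<^sub>R T"
    have g: "g \<in> subdifferential h p" unfolding g_def p_def by (rule prox_subgradient[OF cl pr co T])
    obtain b where b: "h p = ereal b"
      using proper_fun_ereal[OF pr subdifferential_finite[OF pr g]] by blast
    have Tg: "T *\<^sub>R g = u + T *\<^sub>R s - p" using T by (simp add: g_def)
    then have pu: "p - u = T *\<^sub>R (s - g)" by (simp add: algebra_simps)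
    have "ereal (b + g \<bullet> (u - p)) \<le> ereal a" using g a b by (auto simp: subdifferential_def dest: spec[of _ u])
    moreover have "s \<bullet> p - K \<le> b" using K[of p] b by simp
    ultimately have "(s - g) \<bullet> (p - u) \<le> D" by (simp add: D_def inner_simps)
    then have "T * (norm (s - g))\<^sup>2 \<le> D" by (simp add: pu power2_norm_eq_inner)
    also have "D < T * e\<^sup>2" using e by (simp add: T_def)
    finally have "(norm (s - g))\<^sup>2 < e\<^sup>2" using T by simp
    then have "dist g s < e" using e by (simp add: dist_norm power2_less_imp_less norm_minus_commute)
    then show "\<exists>y\<in>range_subdifferential h. dist y s < e"
      using g by (auto simp: range_subdifferential_def)
  qed
qed

lemma closure_range_subdifferential:
  fixes h :: "'a::{real_inner, complete_space} \<Rightarrow> ereal"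
  assumes "closed_fun h" and "proper_fun h" and "convex_fun h"
  shows "closure (range_subdifferential h) = closure (affine_minorant_slopes h)"
  using range_subdifferential_subset_slopes[OF assms(2)]
    slopes_subset_closure_range_subdifferential[OF assms]
  by (metis closure_closure closure_mono subset_antisym)

section \<open>The minimal norm element and its variational inequality\<close>

text \<open>The proximal problem for the indicator function of \<open>C\<close> is projection onto
  \<open>C\<close>; it is solved here at the origin.\<close>

lemma closed_convex_min_norm_exists:
  fixes C :: "'a::{real_inner, complete_space} set"
  assumes "closed C" and "convex C" and "C \<noteq> {}"
  obtains z where "z \<in> C" and "\<And>w. w \<in> C \<Longrightarrow> norm z \<le> norm w"
proof -
  define h where "h y = (if y \<in> C then 0 else (\<infinity>::ereal))" for y
  have "closed_fun h"
    unfolding closed_fun_def le_Liminf_iff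
  proof (intro allI impI)
    fix x a assume a: "a < h x"
    show "\<forall>\<^sub>F y in at x. a < h y"
    proof (cases "x \<in> C")
      case True
      have "a < h y" for y using a True by (cases a) (auto simp: h_def)
      then show ?thesis by simp
    next
      case False
      then have "\<forall>\<^sub>F y in nhds x. y \<in> - C"
        using assms(1) by (intro eventually_nhds_in_open) auto
      then have "\<forall>\<^sub>F y in at x. y \<in> - C" by (simp add: eventually_nhds_conv_at)
      then show ?thesis by eventually_elim (use a False in \<open>auto simp: h_def\<close>)
    qed
  qed
  moreover have "proper_fun h" using assms(3) by (auto simp: proper_fun_def h_def)
  moreover have "convex_fun h"
    unfolding convex_fun_def
  proof (intro allI impI)
    fix x y and u v :: real assume uv: "0 \<le> u" "0 \<le> v" "u + v = 1"
    \<comment> \<open>Zero weights are split off: there \<open>0 * \<infinity> = 0\<close>, and the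
      corresponding point may lie outside \<open>C\<close>.\<close>
    then have "u > 0 \<or> u = 0" "v > 0 \<or> v = 0" by auto
    then show "h (u *\<^sub>R x + v *\<^sub>R y) \<le> ereal u * h x + ereal v * h y"
      using convexD[OF assms(2) _ _ uv, of x y] uv by (auto simp: h_def)
  qed
  ultimately obtain z where z: "h z < \<infinity>"
    "\<And>y. h z + ereal (1 * (norm (0 - z))\<^sup>2) \<le> h y + ereal (1 * (norm (0 - y))\<^sup>2)"
    using prox_minimiser_exists[of h 1 0] by (metis zero_less_one)
  have zC: "z \<in> C" using z(1) by (auto simp: h_def split: if_splits)
  have "norm z \<le> norm w" if "w \<in> C" for w
    using z(2)[of w] that zC by (simp add: h_def)
  with zC show ?thesis using that by blast
qed

text \<open>The closure of the range equals the closure of the slopes, a closed convex set, so the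
  minimum is attained; the second claim is the obtuse angle property of the projection of 0.\<close>

lemma min_norm_subgradient_closure:
  fixes h :: "'a::{real_inner, complete_space} \<Rightarrow> ereal"
  assumes cl: "closed_fun h" and pr: "proper_fun h" and co: "convex_fun h"
  shows "min_norm_subgradient h \<in> closure (affine_minorant_slopes h)" (is "?s \<in> ?C")
    and "w \<in> closure (affine_minorant_slopes h) \<Longrightarrow>
      (norm (min_norm_subgradient h))\<^sup>2 \<le> min_norm_subgradient h \<bullet> w"
proof -
  have cvx: "convex ?C" by (intro convex_closure convex_affine_minorant_slopes)
  \<comment> \<open>Any proximal step yields a subgradient, so the set is nonempty.\<close>
  have "(0 - prox 1 h 0) /\<^sub>R 1 \<in> range_subdifferential h"
    using prox_subgradient[OF cl pr co, of 1 0] by (auto simp: range_subdifferential_def)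
  then have "?C \<noteq> {}" using range_subdifferential_subset_slopes[OF pr] by auto
  then obtain z where "z \<in> ?C" "\<And>w. w \<in> ?C \<Longrightarrow> norm z \<le> norm w"
    using closed_convex_min_norm_exists[OF closed_closure cvx] by blast
  then have "is_arg_min (\<lambda>s. (norm s)\<^sup>2) (\<lambda>s. s \<in> ?C) z"
    by (simp add: is_arg_min_linorder)
  then have "is_arg_min (\<lambda>s. (norm s)\<^sup>2) (\<lambda>s. s \<in> ?C) ?s"
    unfolding min_norm_subgradient_def arg_min_on_def arg_min_def closure_range_subdifferential[OF assms]
    by (rule someI)
  then have *: "?s \<in> ?C" "\<And>w. w \<in> ?C \<Longrightarrow> norm ?s \<le> norm w"
    by (auto simp: is_arg_min_linorder)
  show "?s \<in> ?C" by fact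
  assume "w \<in> ?C"
  then have "(0 - ?s) \<bullet> (w - ?s) \<le> 0"
    using * by (intro any_closest_point_dot[OF cvx closed_closure]) auto
  then show "(norm ?s)\<^sup>2 \<le> ?s \<bullet> w" by (simp add: inner_simps power2_norm_eq_inner)
qed

lemma convex_conjugate_finite_slope:
  assumes "proper_fun h" and "convex_conjugate h s < \<infinity>"
  shows "s \<in> affine_minorant_slopes h"
proof -
  obtain K where K: "convex_conjugate h s \<le> ereal K"
    using assms(2) by (cases "convex_conjugate h s") auto
  have "ereal (s \<bullet> y - K) \<le> h y" for y
  proof -
    have "ereal (s \<bullet> y) - h y \<le> ereal K"
      using K unfolding convex_conjugate_def by (meson SUP_upper UNIV_I order_trans)
    then show ?thesis using assms(1) by (cases "h y") (auto simp: proper_fun_def)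
  qed
  then show ?thesis unfolding affine_minorant_slopes_def by blast
qed

section \<open>Setup of the inexact iteration\<close>

text \<open>The iteration constrains \<open>sstar\<close> and \<open>s\<close> only from index 1 on,
  so estimates are proved at \<open>Suc n\<close> and transferred by this lemma.\<close>

lemma bigo_shift:
  fixes f g :: "nat \<Rightarrow> real"
  assumes "\<forall>\<^sub>F n in sequentially. \<bar>f (Suc n)\<bar> \<le> c * \<bar>g (Suc n)\<bar>"
  shows "f \<in> O(g)"
  using assms eventually_sequentially_Suc[of "\<lambda>n. \<bar>f n\<bar> \<le> c * \<bar>g n\<bar>"] by (intro bigoI[where c = c]) simp

locale inexact_prox_iteration =
  fixes h :: "'a::{real_inner, complete_space} \<Rightarrow> ereal"
    and \<gamma> \<epsilon> :: "nat \<Rightarrow> real"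
    and lstar sstar l s :: "nat \<Rightarrow> 'a"
  assumes closed_h: "closed_fun h" and proper_h: "proper_fun h" and convex_h: "convex_fun h"
    and conditions: "error_step_conditions \<gamma> \<epsilon>"
    and iteration: "ippa h \<gamma> \<epsilon> lstar sstar l s"
begin

definition T :: "nat \<Rightarrow> real" where "T n = (\<Sum>i<n. \<gamma> i)"

text \<open>Faithful to \<open>h\<close> at successor indices only, where the prox points have
  finite value.\<close>

definition H :: "nat \<Rightarrow> real" where "H k = real_of_ereal (h (lstar k))"

definition err :: "nat \<Rightarrow> 'a" where "err k = l k - lstar k"

lemma \<gamma>_pos: "\<gamma> k > 0"
  using conditions by (simp add: error_step_conditions_def)

lemma T_Suc: "T (Suc n) = T n + \<gamma> n"
  by (simp add: T_def)

lemma T_mono: "m \<le> n \<Longrightarrow> T m \<le> T n"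
  unfolding T_def using \<gamma>_pos by (intro sum_mono2) (auto intro: less_imp_le)

lemma T_Suc_ge: "\<gamma> 0 \<le> T (Suc n)"
  using T_mono[of 1 "Suc n"] by (simp add: T_def)

lemma T_Suc_pos: "T (Suc n) > 0"
  using T_Suc_ge[of n] \<gamma>_pos[of 0] by linarith

lemma T_at_top: "filterlim T at_top sequentially"
  using conditions by (simp add: error_step_conditions_def T_def[abs_def])

lemma \<epsilon>_nonneg: "\<epsilon> (Suc k) \<ge> 0"
  using conditions by (simp add: error_step_conditions_def)

lemma summable_\<epsilon>: "summable (\<lambda>k. \<epsilon> (Suc k))"
  using conditions by (simp add: error_step_conditions_def)

lemma summable_weighted_\<epsilon>: "summable (\<lambda>k. T (Suc k) * (\<epsilon> (Suc k) / \<gamma> (Suc k))\<^sup>2)"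
  using conditions unfolding error_step_conditions_def T_def by (simp only: mult.commute)

lemma norm_err: "norm (err (Suc k)) \<le> \<epsilon> (Suc k)"
  using iteration unfolding ippa_def err_def by blast

lemma lstar_Suc: "lstar (Suc k) = l k - \<gamma> k *\<^sub>R sstar (Suc k)"
  using iteration \<gamma>_pos[of k] by (simp add: ippa_def)

text \<open>Eliminating \<open>l\<close> leaves a recursion in the exact prox points, with the
  inexactness as a perturbation of the point from which the step starts.\<close>

lemma lstar_Suc_Suc: "lstar (Suc (Suc k)) = lstar (Suc k) + err (Suc k) - \<gamma> (Suc k) *\<^sub>R sstar (Suc (Suc k))"
  by (simp add: err_def lstar_Suc[of "Suc k"])

lemma sstar_subgradient: "sstar (Suc k) \<in> subdifferential h (lstar (Suc k))"
  using iteration prox_subgradient[OF closed_h proper_h convex_h \<gamma>_pos[of k], of "l k"]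
  by (simp add: ippa_def)

lemma h_lstar: "h (lstar (Suc k)) = ereal (H (Suc k))"
  unfolding H_def using subdifferential_finite[OF proper_h sstar_subgradient] by (rule proper_fun_ereal[OF proper_h])

lemma subgradient_ineq:
  "h u = ereal a \<Longrightarrow> H (Suc k) + sstar (Suc k) \<bullet> (u - lstar (Suc k)) \<le> a"
  using sstar_subgradient[of k] h_lstar[of k]
  by (auto simp: subdifferential_def dest!: spec[of _ u])

section \<open>Energy estimates along the iteration\<close>

text \<open>Exact steps never increase the subgradient norm, by monotonicity of the subdifferential.
  With errors, the increase is only quadratic in \<open>err\<close>, which matches the summability
  condition on squared errors.\<close>

lemma sstar_norm_step:
  "(norm (sstar (Suc (Suc k))))\<^sup>2 \<le>
    (norm (sstar (Suc k)))\<^sup>2 + (norm (err (Suc k)) / \<gamma> (Suc k))\<^sup>2"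
proof -
  define d where "d = sstar (Suc (Suc k)) - sstar (Suc k)"
  define f where "f = err (Suc k) /\<^sub>R \<gamma> (Suc k)"
  have diff: "lstar (Suc (Suc k)) - lstar (Suc k) = \<gamma> (Suc k) *\<^sub>R (f - sstar (Suc (Suc k)))"
    using \<gamma>_pos[of "Suc k"] by (simp add: lstar_Suc_Suc f_def algebra_simps)
  have "0 \<le> d \<bullet> (lstar (Suc (Suc k)) - lstar (Suc k))"
    using subgradient_ineq[OF h_lstar, of k "Suc k"] subgradient_ineq[OF h_lstar, of "Suc k" k]
    by (simp add: d_def inner_simps)
  then have "0 \<le> d \<bullet> (f - sstar (Suc (Suc k)))"
    using \<gamma>_pos[of "Suc k"] by (simp add: diff zero_le_mult_iff)
  \<comment> \<open>The cross term \<open>2 * (d \<bullet> f)\<close> is absorbed by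
    \<open>(norm d)\<^sup>2\<close>, available from expanding the difference of squared norms, and
    \<open>(norm f)\<^sup>2\<close>.\<close>
  moreover have "0 \<le> (norm (d - f))\<^sup>2" by simp
  ultimately have "(norm (sstar (Suc (Suc k))))\<^sup>2 \<le> (norm (sstar (Suc k)))\<^sup>2 + (norm f)\<^sup>2"
    unfolding power2_norm_eq_inner by (simp add: d_def inner_simps inner_commute)
  moreover have "norm f = norm (err (Suc k)) / \<gamma> (Suc k)"
    using \<gamma>_pos[of "Suc k"] by (simp add: f_def divide_inverse mult.commute)
  ultimately show ?thesis by simp
qed

text \<open>
  The exact version of this Lyapunov function is due to Gueler. One step uses the subgradient
  inequality at \<open>lstar (Suc (Suc k))\<close> towards \<open>u\<close> with weight \<open>2 * \<gamma> (Suc k)\<close>, towards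
  \<open>lstar (Suc k)\<close> with weight \<open>2 * T (Suc k)\<close>, and \<open>sstar_norm_step\<close> with weight \<open>(T (Suc k))\<^sup>2\<close>.
\<close>

lemma lyapunov_bound:
  assumes u: "h u = ereal a"
  shows "(T (Suc n))\<^sup>2 * (norm (sstar (Suc n)))\<^sup>2 + 2 * T (Suc n) * (H (Suc n) - a)
      + (norm (lstar (Suc n) - u))\<^sup>2
    \<le> (norm (l 0 - u))\<^sup>2 + (\<Sum>k<n. 2 * (err (Suc k) \<bullet> (lstar (Suc k) - u)) + (norm (err (Suc k)))\<^sup>2
        + 2 * T (Suc k) * (sstar (Suc (Suc k)) \<bullet> err (Suc k))
        + (T (Suc k))\<^sup>2 * (norm (err (Suc k)) / \<gamma> (Suc k))\<^sup>2)"
proof (induction n)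
  case 0
  define v where "v = lstar (Suc 0) - u"
  have "l 0 - u = v + \<gamma> 0 *\<^sub>R sstar (Suc 0)" by (simp add: v_def lstar_Suc)
  then have "(norm (l 0 - u))\<^sup>2
      = (norm v)\<^sup>2 + 2 * \<gamma> 0 * (sstar (Suc 0) \<bullet> v) + (\<gamma> 0)\<^sup>2 * (norm (sstar (Suc 0)))\<^sup>2"
    unfolding power2_norm_eq_inner by (simp add: inner_simps inner_commute power2_eq_square)
  moreover have "H (Suc 0) - a \<le> sstar (Suc 0) \<bullet> v"
    using subgradient_ineq[OF u, of 0] by (simp add: v_def inner_simps)
  then have "2 * \<gamma> 0 * (H (Suc 0) - a) \<le> 2 * \<gamma> 0 * (sstar (Suc 0) \<bullet> v)"
    using \<gamma>_pos[of 0] by (intro mult_left_mono) auto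
  ultimately show ?case by (simp add: T_def v_def)
next
  case (Suc n)
  define t c where "t = T (Suc n)" and "c = \<gamma> (Suc n)"
  define g where "g = sstar (Suc (Suc n))"
  define v where "v = lstar (Suc n) - u"
  define e where "e = err (Suc n)"
  define D where "D = (norm e / c)\<^sup>2"
  have pos: "t > 0" "c > 0" by (simp_all add: t_def c_def T_Suc_pos \<gamma>_pos)
  have v': "lstar (Suc (Suc n)) - u = v + e - c *\<^sub>R g"
    by (simp add: lstar_Suc_Suc v_def e_def c_def g_def)
  have "H (Suc (Suc n)) - a \<le> g \<bullet> (lstar (Suc (Suc n)) - u)"
    using subgradient_ineq[OF u, of "Suc n"] by (simp add: g_def inner_simps)
  then have "H (Suc (Suc n)) - a \<le> g \<bullet> (v + e - c *\<^sub>R g)" unfolding v' .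
  then have 1: "2 * c * (H (Suc (Suc n)) - a) \<le> 2 * c * (g \<bullet> v + g \<bullet> e - c * (g \<bullet> g))"
    using pos by (intro mult_left_mono) (auto simp: inner_simps)
  have "H (Suc (Suc n)) - H (Suc n) \<le> g \<bullet> e - c * (g \<bullet> g)"
    using subgradient_ineq[OF h_lstar, of "Suc n" n]
    by (simp add: g_def e_def c_def lstar_Suc_Suc inner_simps)
  then have 2: "2 * t * (H (Suc (Suc n)) - H (Suc n)) \<le> 2 * t * (g \<bullet> e - c * (g \<bullet> g))"
    using pos by (intro mult_left_mono) auto
  have "(norm g)\<^sup>2 \<le> (norm (sstar (Suc n)))\<^sup>2 + D"
    using sstar_norm_step[of n] by (simp add: g_def e_def c_def D_def)
  then have 3: "t\<^sup>2 * (norm g)\<^sup>2 \<le> t\<^sup>2 * ((norm (sstar (Suc n)))\<^sup>2 + D)"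
    by (intro mult_left_mono) auto
  have 4: "(norm (v + e - c *\<^sub>R g))\<^sup>2 = (norm v)\<^sup>2 + 2 * (e \<bullet> v) + (norm e)\<^sup>2
      - 2 * c * (g \<bullet> v + g \<bullet> e) + c\<^sup>2 * (g \<bullet> g)"
    unfolding power2_norm_eq_inner by (simp add: inner_simps inner_commute power2_eq_square algebra_simps)
  have 5: "(t + c)\<^sup>2 * (norm g)\<^sup>2 = t\<^sup>2 * (norm g)\<^sup>2 + 2 * t * c * (g \<bullet> g) + c\<^sup>2 * (g \<bullet> g)"
    unfolding power2_norm_eq_inner by (simp add: power2_eq_square algebra_simps)
  have T: "T (Suc (Suc n)) = t + c" by (simp add: T_Suc t_def c_def)
  \<comment> \<open>Adding 1, 2 and 3 cancels every \<open>g \<bullet> g\<close> from 4 and 5: 1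
    supplies \<open>- 2 * c\<^sup>2\<close> and 2 supplies \<open>- 2 * t * c\<close> as
    coefficients. The rest is exactly the summand with index \<open>n\<close>.\<close>
  have "(t + c)\<^sup>2 * (norm g)\<^sup>2 + 2 * (t + c) * (H (Suc (Suc n)) - a) + (norm (v + e - c *\<^sub>R g))\<^sup>2
      \<le> t\<^sup>2 * (norm (sstar (Suc n)))\<^sup>2 + 2 * t * (H (Suc n) - a) + (norm v)\<^sup>2
        + (2 * (e \<bullet> v) + (norm e)\<^sup>2 + 2 * t * (g \<bullet> e) + t\<^sup>2 * D)"
    using 1 2 3 unfolding 4 5 by (simp add: algebra_simps power2_eq_square)
  moreover note Suc.IH
  ultimately show ?case
    unfolding sum.lessThan_Suc T v' by (simp add: t_def c_def g_def v_def e_def D_def)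
qed

section \<open>A priori bounds and the key estimate for the subgradient norms\<close>

lemma sum_\<epsilon>_le: "(\<Sum>k<n. \<epsilon> (Suc k)) \<le> (\<Sum>k. \<epsilon> (Suc k))"
  using sum_le_suminf[OF summable_\<epsilon>, of "{..<n}"] \<epsilon>_nonneg by simp

lemma err_sq_le: "(norm (err (Suc k)) / \<gamma> (Suc k))\<^sup>2 \<le> (\<epsilon> (Suc k) / \<gamma> (Suc k))\<^sup>2"
  using norm_err \<gamma>_pos by (intro power_mono divide_right_mono) (auto simp: less_imp_le)

text \<open>Sums \<open>sstar_norm_step\<close>. The squared errors are summable with weights
  \<open>T (Suc k) \<ge> \<gamma> 0\<close>, hence the scaling by \<open>\<gamma> 0\<close>.\<close>

lemma sstar_bounded: "\<exists>G. \<forall>k. norm (sstar (Suc k)) \<le> G"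
proof -
  define W where "W = (\<Sum>k. T (Suc k) * (\<epsilon> (Suc k) / \<gamma> (Suc k))\<^sup>2)"
  have W: "(\<Sum>k<n. T (Suc k) * (\<epsilon> (Suc k) / \<gamma> (Suc k))\<^sup>2) \<le> W" for n
    unfolding W_def using T_Suc_pos by (intro sum_le_suminf[OF summable_weighted_\<epsilon>]) (auto simp: less_imp_le)
  have "\<gamma> 0 * (norm (sstar (Suc n)))\<^sup>2 \<le> \<gamma> 0 * (norm (sstar (Suc 0)))\<^sup>2
      + (\<Sum>k<n. T (Suc k) * (\<epsilon> (Suc k) / \<gamma> (Suc k))\<^sup>2)" for n
  proof (induction n)
    case (Suc n)
    have "\<gamma> 0 * (norm (sstar (Suc (Suc n))))\<^sup>2
        \<le> \<gamma> 0 * ((norm (sstar (Suc n)))\<^sup>2 + (\<epsilon> (Suc n) / \<gamma> (Suc n))\<^sup>2)"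
      using sstar_norm_step[of n] err_sq_le[of n] \<gamma>_pos[of 0] by (intro mult_left_mono) auto
    moreover have "\<gamma> 0 * (\<epsilon> (Suc n) / \<gamma> (Suc n))\<^sup>2 \<le> T (Suc n) * (\<epsilon> (Suc n) / \<gamma> (Suc n))\<^sup>2"
      using T_Suc_ge[of n] by (intro mult_right_mono) auto
    ultimately show ?case using Suc.IH by (simp add: distrib_left)
  qed simp
  then have "\<gamma> 0 * (norm (sstar (Suc n)))\<^sup>2 \<le> \<gamma> 0 * (norm (sstar (Suc 0)))\<^sup>2 + W" for n
    using W[of n] by (meson add_left_mono order_trans)
  then have "(norm (sstar (Suc n)))\<^sup>2 \<le> (norm (sstar (Suc 0)))\<^sup>2 + W / \<gamma> 0" for n
    using \<gamma>_pos[of 0] by (simp add: field_simps)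
  then have "norm (sstar (Suc n)) \<le> sqrt ((norm (sstar (Suc 0)))\<^sup>2 + W / \<gamma> 0)" for n
    by (rule real_le_rsqrt)
  then show ?thesis by blast
qed

text \<open>Growth at most linear in \<open>T\<close> is what keeps the error terms
  \<open>err (Suc k) \<bullet> (lstar (Suc k) - u)\<close> of the Lyapunov bound at order
  \<open>T\<close> after summation.\<close>

lemma lstar_dist_le:
  assumes G: "\<And>k. norm (sstar (Suc k)) \<le> G"
  shows "norm (lstar (Suc n) - u) \<le> norm (l 0 - u) + (\<Sum>k. \<epsilon> (Suc k)) + G * T (Suc n)"
proof -
  have "norm (lstar (Suc n) - u) \<le> norm (l 0 - u) + (\<Sum>k<n. \<epsilon> (Suc k)) + G * T (Suc n)"
  proof (induction n)
    case 0
    have "norm (lstar (Suc 0) - u) \<le> norm (l 0 - u) + norm (\<gamma> 0 *\<^sub>R sstar (Suc 0))"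
      using norm_triangle_ineq4[of "l 0 - u" "\<gamma> 0 *\<^sub>R sstar (Suc 0)"] by (simp add: lstar_Suc algebra_simps)
    also have "\<dots> \<le> norm (l 0 - u) + G * T (Suc 0)"
      using G[of 0] \<gamma>_pos[of 0] by (simp add: T_def mult.commute)
    finally show ?case by simp
  next
    case (Suc n)
    have "lstar (Suc (Suc n)) - u = (lstar (Suc n) - u) + err (Suc n) - \<gamma> (Suc n) *\<^sub>R sstar (Suc (Suc n))"
      by (simp add: lstar_Suc_Suc)
    then have "norm (lstar (Suc (Suc n)) - u) \<le>
        norm (lstar (Suc n) - u) + norm (err (Suc n)) + norm (\<gamma> (Suc n) *\<^sub>R sstar (Suc (Suc n)))"
      using norm_triangle_ineq4[of "lstar (Suc n) - u + err (Suc n)" "\<gamma> (Suc n) *\<^sub>R sstar (Suc (Suc n))"]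
        norm_triangle_ineq[of "lstar (Suc n) - u" "err (Suc n)"] by (simp only:)
    moreover have "norm (\<gamma> (Suc n) *\<^sub>R sstar (Suc (Suc n))) \<le> G * \<gamma> (Suc n)"
      using G[of "Suc n"] \<gamma>_pos[of "Suc n"] by (simp add: mult.commute)
    ultimately show ?case using Suc.IH norm_err[of n] by (simp add: T_Suc[of "Suc n"] distrib_left)
  qed
  then show ?thesis using sum_\<epsilon>_le[of n] by linarith
qed

text \<open>The constant depends on \<open>w\<close> through the intercept \<open>K\<close>, which
  may blow up as \<open>w\<close> approaches a boundary point of the slopes; hence \<open>w\<close>
  is kept arbitrary.\<close>

lemma sstar_norm_bound:
  assumes "w \<in> affine_minorant_slopes h"
  obtains C where "\<And>n. (norm (sstar (Suc n)))\<^sup>2 - (norm w)\<^sup>2 \<le> C / T (Suc n)"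
proof -
  obtain K where K: "\<And>y. ereal (w \<bullet> y - K) \<le> h y"
    using assms unfolding affine_minorant_slopes_def by blast
  obtain u where "h u < \<infinity>" using proper_h by (auto simp: proper_fun_def)
  then obtain a where a: "h u = ereal a" using proper_fun_ereal[OF proper_h] by blast
  obtain G where G: "\<And>k. norm (sstar (Suc k)) \<le> G" using sstar_bounded by blast
  have G0: "G \<ge> 0" using G[of 0] norm_ge_zero order_trans by blast
  define E where "E = (\<Sum>k. \<epsilon> (Suc k))"
  define W where "W = (\<Sum>k. T (Suc k) * (\<epsilon> (Suc k) / \<gamma> (Suc k))\<^sup>2)"
  define A where "A = norm (l 0 - u) + E"
  have E: "\<epsilon> (Suc k) \<le> E" for k
    using sum_le_suminf[OF summable_\<epsilon>, of "{k}"] \<epsilon>_nonneg by (simp add: E_def)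
  have E0: "E \<ge> 0" using E[of 0] \<epsilon>_nonneg[of 0] by linarith
  have A0: "A \<ge> 0" using E0 by (simp add: A_def)
  define Q where "Q = (norm (l 0 - u))\<^sup>2 + E * (2 * A + E)"
  \<comment> \<open>\<open>2 * (a + K - w \<bullet> u)\<close> comes from the affine minorant,
    \<open>Q / \<gamma> 0\<close> from terms free of \<open>T\<close> (using
    \<open>\<gamma> 0 \<le> T (Suc n)\<close>), \<open>4 * G * E\<close> from the two inner products
    with \<open>err\<close>, and \<open>W\<close> from the weighted squared errors.\<close>
  define C where "C = 2 * (a + K - w \<bullet> u) + Q / \<gamma> 0 + 4 * G * E + W"
  have Q0: "Q \<ge> 0" using A0 E0 by (simp add: Q_def)
  have "(norm (sstar (Suc n)))\<^sup>2 - (norm w)\<^sup>2 \<le> C / T (Suc n)" for n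
  proof -
    define t where "t = T (Suc n)"
    have t: "t > 0" by (simp add: t_def T_Suc_pos)
    define p where "p = lstar (Suc n)"
    have "(\<Sum>k<n. 2 * (err (Suc k) \<bullet> (lstar (Suc k) - u)) + (norm (err (Suc k)))\<^sup>2
        + 2 * T (Suc k) * (sstar (Suc (Suc k)) \<bullet> err (Suc k))
        + (T (Suc k))\<^sup>2 * (norm (err (Suc k)) / \<gamma> (Suc k))\<^sup>2)
      \<le> (\<Sum>k<n. \<epsilon> (Suc k) * (2 * A + E + 4 * G * t)
          + t * (T (Suc k) * (\<epsilon> (Suc k) / \<gamma> (Suc k))\<^sup>2))"
    proof (rule sum_mono)
      fix k assume "k \<in> {..<n}"
      then have tk: "T (Suc k) \<le> t" unfolding t_def by (intro T_mono) auto
      have tk0: "T (Suc k) > 0" by (rule T_Suc_pos)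
      have "norm (lstar (Suc k) - u) \<le> A + G * T (Suc k)"
        using lstar_dist_le[OF G, of k u] by (simp add: A_def E_def)
      also have "\<dots> \<le> A + G * t" using tk G0 by (simp add: mult_left_mono)
      finally have "norm (err (Suc k)) * norm (lstar (Suc k) - u) \<le> \<epsilon> (Suc k) * (A + G * t)"
        using norm_err \<epsilon>_nonneg by (intro mult_mono) auto
      then have 1: "err (Suc k) \<bullet> (lstar (Suc k) - u) \<le> \<epsilon> (Suc k) * (A + G * t)"
        using norm_cauchy_schwarz order_trans by blast
      have 2: "(norm (err (Suc k)))\<^sup>2 \<le> \<epsilon> (Suc k) * E"
        unfolding power2_eq_square using norm_err[of k] E[of k] \<epsilon>_nonneg[of k] by (intro mult_mono) auto
      have "norm (sstar (Suc (Suc k))) * norm (err (Suc k)) \<le> G * \<epsilon> (Suc k)"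
        using G norm_err G0 by (intro mult_mono) auto
      then have "sstar (Suc (Suc k)) \<bullet> err (Suc k) \<le> G * \<epsilon> (Suc k)"
        using norm_cauchy_schwarz order_trans by blast
      then have "T (Suc k) * (sstar (Suc (Suc k)) \<bullet> err (Suc k)) \<le> T (Suc k) * (G * \<epsilon> (Suc k))"
        using tk0 by (intro mult_left_mono) auto
      also have "\<dots> \<le> t * (G * \<epsilon> (Suc k))"
        using tk G0 \<epsilon>_nonneg by (intro mult_right_mono) auto
      finally have 3: "T (Suc k) * (sstar (Suc (Suc k)) \<bullet> err (Suc k)) \<le> t * (G * \<epsilon> (Suc k))" .
      have "(T (Suc k))\<^sup>2 * (norm (err (Suc k)) / \<gamma> (Suc k))\<^sup>2
          \<le> (T (Suc k))\<^sup>2 * (\<epsilon> (Suc k) / \<gamma> (Suc k))\<^sup>2"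
        using err_sq_le by (intro mult_left_mono) auto
      also have "\<dots> = T (Suc k) * (T (Suc k) * (\<epsilon> (Suc k) / \<gamma> (Suc k))\<^sup>2)"
        by (simp add: power2_eq_square)
      also have "\<dots> \<le> t * (T (Suc k) * (\<epsilon> (Suc k) / \<gamma> (Suc k))\<^sup>2)"
        using tk tk0 by (intro mult_right_mono) auto
      finally show "2 * (err (Suc k) \<bullet> (lstar (Suc k) - u)) + (norm (err (Suc k)))\<^sup>2
          + 2 * T (Suc k) * (sstar (Suc (Suc k)) \<bullet> err (Suc k))
          + (T (Suc k))\<^sup>2 * (norm (err (Suc k)) / \<gamma> (Suc k))\<^sup>2
        \<le> \<epsilon> (Suc k) * (2 * A + E + 4 * G * t) + t * (T (Suc k) * (\<epsilon> (Suc k) / \<gamma> (Suc k))\<^sup>2)"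
        using 1 2 3 by (simp add: algebra_simps)
    qed
    also have "\<dots> = (\<Sum>k<n. \<epsilon> (Suc k)) * (2 * A + E + 4 * G * t)
          + t * (\<Sum>k<n. T (Suc k) * (\<epsilon> (Suc k) / \<gamma> (Suc k))\<^sup>2)"
      by (simp only: sum.distrib sum_distrib_left sum_distrib_right)
    also have "\<dots> \<le> E * (2 * A + E + 4 * G * t) + t * W"
    proof (intro add_mono mult_right_mono mult_left_mono)
      show "(\<Sum>k<n. \<epsilon> (Suc k)) \<le> E" unfolding E_def by (rule sum_\<epsilon>_le)
      show "(\<Sum>k<n. T (Suc k) * (\<epsilon> (Suc k) / \<gamma> (Suc k))\<^sup>2) \<le> W"
        unfolding W_def using T_Suc_pos
        by (intro sum_le_suminf[OF summable_weighted_\<epsilon>]) (auto simp: less_imp_le)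
    qed (use A0 E0 G0 t in auto)
    finally have "t\<^sup>2 * (norm (sstar (Suc n)))\<^sup>2 + 2 * t * (H (Suc n) - a) + (norm (p - u))\<^sup>2
        \<le> Q + t * (4 * G * E + W)"
      using lyapunov_bound[OF a, of n] by (simp add: t_def p_def Q_def algebra_simps)
    moreover have "2 * t * (w \<bullet> p - K) \<le> 2 * t * H (Suc n)"
      using K[of p] h_lstar[of n] t by (simp add: p_def)
    \<comment> \<open>Completing the square: the term in \<open>w \<bullet> p\<close> cancels the
      one from the minorant, which removes both \<open>H (Suc n)\<close> and the unknown distance to
      \<open>u\<close>.\<close>
    moreover have "0 \<le> (norm ((p - u) - (- t) *\<^sub>R w))\<^sup>2" by simp
    then have "0 \<le> (norm (p - u))\<^sup>2 + 2 * t * (w \<bullet> p - w \<bullet> u) + t\<^sup>2 * (norm w)\<^sup>2"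
      unfolding norm_diff_scaleR_sq by (simp add: inner_simps inner_commute)
    moreover have "Q \<le> Q / \<gamma> 0 * t"
      using mult_left_mono[OF T_Suc_ge Q0, of n] \<gamma>_pos[of 0] by (simp add: t_def field_simps)
    ultimately have "t\<^sup>2 * (norm (sstar (Suc n)))\<^sup>2 \<le> t\<^sup>2 * (norm w)\<^sup>2 + t * C"
      unfolding C_def by (simp add: algebra_simps)
    then have "t * (t * ((norm (sstar (Suc n)))\<^sup>2 - (norm w)\<^sup>2)) \<le> t * C"
      by (simp add: power2_eq_square algebra_simps)
    then have "t * ((norm (sstar (Suc n)))\<^sup>2 - (norm w)\<^sup>2) \<le> C" using t by simp
    then show ?thesis using t by (simp add: t_def[symmetric] field_simps)
  qed
  then show thesis using that by blast
qed

section \<open>Norm convergence\<close>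

abbreviation sbar :: 'a where "sbar \<equiv> min_norm_subgradient h"

text \<open>Expand the square and apply the variational inequality of \<open>sbar\<close> to the
  subgradient \<open>sstar (Suc n)\<close>; convergence of norms thus upgrades to convergence in
  norm.\<close>

lemma sstar_dist_sbar: "(norm (sstar (Suc n) - sbar))\<^sup>2 \<le> (norm (sstar (Suc n)))\<^sup>2 - (norm sbar)\<^sup>2"
proof -
  have "sstar (Suc n) \<in> closure (affine_minorant_slopes h)"
    using sstar_subgradient[of n] range_subdifferential_subset_slopes[OF proper_h] closure_subset
    by (fastforce simp: range_subdifferential_def)
  then have "(norm sbar)\<^sup>2 \<le> sbar \<bullet> sstar (Suc n)"
    by (rule min_norm_subgradient_closure(2)[OF closed_h proper_h convex_h])
  then show ?thesis
    by (simp add: power2_norm_eq_inner inner_simps inner_commute)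
qed

text \<open>\<open>sbar\<close> lies only in the closure of the slopes, so a nearby slope
  \<open>w\<close> replaces it: half of \<open>r\<^sup>2\<close> pays for the change of squared
  norm, half for \<open>C / T (Suc n)\<close>.\<close>

lemma sstar_tendsto: "sstar \<longlonglongrightarrow> sbar"
proof (rule LIMSEQ_imp_Suc, rule tendstoI)
  fix r :: real assume r: "r > 0"
  have sb: "sbar \<in> closure (affine_minorant_slopes h)"
    by (rule min_norm_subgradient_closure(1)[OF closed_h proper_h convex_h])
  have "isCont (\<lambda>w. (norm w)\<^sup>2) sbar" by (intro continuous_intros)
  then obtain d where d: "d > 0"
    "\<And>w. dist w sbar < d \<Longrightarrow> \<bar>(norm w)\<^sup>2 - (norm sbar)\<^sup>2\<bar> < r\<^sup>2 / 2"
    using r unfolding continuous_at_eps_delta dist_real_def by (metis half_gt_zero zero_less_power)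
  obtain w where w: "w \<in> affine_minorant_slopes h" "dist w sbar < d"
    using sb d(1) unfolding closure_approachable by blast
  obtain C where C: "\<And>n. (norm (sstar (Suc n)))\<^sup>2 - (norm w)\<^sup>2 \<le> C / T (Suc n)"
    using sstar_norm_bound[OF w(1)] by blast
  have "(\<lambda>n. C / T (Suc n)) \<longlonglongrightarrow> 0"
    by (intro tendsto_divide_0[OF tendsto_const] filterlim_at_top_imp_at_infinity
        filterlim_compose[OF T_at_top filterlim_Suc])
  then have "\<forall>\<^sub>F n in sequentially. C / T (Suc n) < r\<^sup>2 / 2"
    using r by (intro order_tendstoD(2)[where y = 0]) auto
  then show "\<forall>\<^sub>F n in sequentially. dist (sstar (Suc n)) sbar < r"
  proof eventually_elim
    case (elim n)
    have "(norm (sstar (Suc n) - sbar))\<^sup>2 < r\<^sup>2"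
      using elim sstar_dist_sbar[of n] C[of n] d(2)[OF w(2)] by argo
    then show ?case using r by (simp add: dist_norm power2_less_imp_less)
  qed
qed

text \<open>The difference is \<open>err\<close> divided by the step size. The big-O condition
  bounds it by a multiple of \<open>T\<close> to the power -3/2, which is weakened to
  \<open>c / T (Suc n)\<close> once \<open>T (Suc n) \<ge> 1\<close>.\<close>

lemma s_sstar_dist:
  obtains c where "c \<ge> 0"
    and "\<forall>\<^sub>F n in sequentially. norm (s (Suc n) - sstar (Suc n)) \<le> c / T (Suc n)"
proof -
  have "(\<lambda>k. \<epsilon> (Suc k) / \<gamma> k * T (Suc k)) \<in> O(\<lambda>k. 1 / sqrt (T (Suc k)))"
    using conditions by (simp add: error_step_conditions_def T_def lessThan_Suc_atMost)
  then obtain c where c: "c > 0"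
    "\<forall>\<^sub>F k in sequentially. norm (\<epsilon> (Suc k) / \<gamma> k * T (Suc k)) \<le> c * norm (1 / sqrt (T (Suc k)))"
    by (elim landau_o.bigE)
  have "\<forall>\<^sub>F k in sequentially. 1 \<le> T (Suc k)"
    using filterlim_compose[OF T_at_top filterlim_Suc] by (simp add: filterlim_at_top)
  with c(2) have "\<forall>\<^sub>F n in sequentially. norm (s (Suc n) - sstar (Suc n)) \<le> c / T (Suc n)"
  proof eventually_elim
    case (elim k)
    have eqs: "s (Suc k) = (l k - l (Suc k)) /\<^sub>R \<gamma> k" "sstar (Suc k) = (l k - lstar (Suc k)) /\<^sub>R \<gamma> k"
      using iteration unfolding ippa_def by blast+
    have "s (Suc k) - sstar (Suc k) = - (err (Suc k) /\<^sub>R \<gamma> k)"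
      unfolding eqs err_def by (simp add: scaleR_diff_right)
    then have "norm (s (Suc k) - sstar (Suc k)) = norm (err (Suc k)) / \<gamma> k"
      using \<gamma>_pos[of k] by (simp add: divide_inverse mult.commute)
    also have "\<dots> \<le> \<epsilon> (Suc k) / \<gamma> k"
      using norm_err \<gamma>_pos by (intro divide_right_mono) (auto simp: less_imp_le)
    finally have "norm (s (Suc k) - sstar (Suc k)) * T (Suc k) \<le> \<epsilon> (Suc k) / \<gamma> k * T (Suc k)"
      using T_Suc_pos[of k] by (intro mult_right_mono) auto
    also have "\<dots> \<le> c * (1 / sqrt (T (Suc k)))"
      using order_trans[OF abs_ge_self elim(1)[unfolded real_norm_def]] T_Suc_pos[of k] by simp
    also have "\<dots> \<le> c * 1" using elim(2) c(1) by (intro mult_left_mono) auto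
    finally show ?case using T_Suc_pos[of k] by (simp add: field_simps)
  qed
  with c(1) show thesis using that less_imp_le by blast
qed

lemma s_minus_sstar_tendsto: "(\<lambda>n. s n - sstar n) \<longlonglongrightarrow> 0"
proof -
  obtain c where c: "\<forall>\<^sub>F n in sequentially. norm (s (Suc n) - sstar (Suc n)) \<le> c / T (Suc n)"
    using s_sstar_dist by blast
  have "(\<lambda>n. c / T (Suc n)) \<longlonglongrightarrow> 0"
    by (intro tendsto_divide_0[OF tendsto_const] filterlim_at_top_imp_at_infinity
        filterlim_compose[OF T_at_top filterlim_Suc])
  then have "(\<lambda>n. s (Suc n) - sstar (Suc n)) \<longlonglongrightarrow> 0"
    by (rule Lim_null_comparison[OF c])
  then show ?thesis by (rule LIMSEQ_imp_Suc)
qed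

lemma s_tendsto: "s \<longlonglongrightarrow> sbar"
  using tendsto_add[OF s_minus_sstar_tendsto sstar_tendsto] by simp

section \<open>Convergence rates\<close>

text \<open>Finiteness of the conjugate makes \<open>sbar\<close> itself a slope, so
  \<open>sstar_norm_bound\<close> applies with \<open>w = sbar\<close>; the rates for
  \<open>s\<close> follow by comparison with \<open>sstar\<close>.\<close>

lemma rates:
  assumes finite: "convex_conjugate h sbar < \<infinity>"
  shows "(\<lambda>N. (norm (sstar N))\<^sup>2 - (norm sbar)\<^sup>2) \<in> O(\<lambda>N. 1 / T N)"
    and "(\<lambda>N. (norm (s N))\<^sup>2 - (norm sbar)\<^sup>2) \<in> O(\<lambda>N. 1 / T N)"
    and "(\<lambda>N. norm (sstar N - sbar)) \<in> O(\<lambda>N. 1 / sqrt (T N))"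
    and "(\<lambda>N. norm (s N - sbar)) \<in> O(\<lambda>N. 1 / sqrt (T N))"
proof -
  obtain C where C: "\<And>n. (norm (sstar (Suc n)))\<^sup>2 - (norm sbar)\<^sup>2 \<le> C / T (Suc n)"
    using sstar_norm_bound[OF convex_conjugate_finite_slope[OF proper_h finite]] by blast
  obtain c where c: "c \<ge> 0"
    "\<forall>\<^sub>F n in sequentially. norm (s (Suc n) - sstar (Suc n)) \<le> c / T (Suc n)"
    using s_sstar_dist by blast
  have T1: "\<forall>\<^sub>F k in sequentially. 1 \<le> T (Suc k)"
    using filterlim_compose[OF T_at_top filterlim_Suc] by (simp add: filterlim_at_top)
  \<comment> \<open>Big-O bounds absolute values, so the upper bound from \<open>C\<close> needs
    this sign.\<close>
  have nonneg: "0 \<le> (norm (sstar (Suc n)))\<^sup>2 - (norm sbar)\<^sup>2" for n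
    using sstar_dist_sbar[of n] zero_le_power2 order_trans by blast
  show a: "(\<lambda>N. (norm (sstar N))\<^sup>2 - (norm sbar)\<^sup>2) \<in> O(\<lambda>N. 1 / T N)"
    using nonneg C abs_of_pos[OF T_Suc_pos] by (intro bigo_shift[where c = C] always_eventually) simp
  have dist_sbar: "norm (sstar (Suc n) - sbar) \<le> sqrt C * (1 / sqrt (T (Suc n)))" for n
    using sstar_dist_sbar[of n] C[of n] by (simp add: real_le_rsqrt flip: real_sqrt_divide)
  then show "(\<lambda>N. norm (sstar N - sbar)) \<in> O(\<lambda>N. 1 / sqrt (T N))"
    using T_Suc_pos by (intro bigo_shift[where c = "sqrt C"] always_eventually) (simp add: less_imp_le)
  have diff: "(\<lambda>N. norm (s N - sstar N)) \<in> O(\<lambda>N. 1 / T N)"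
    using c(2) by (intro bigo_shift[where c = c]) (simp add: T_Suc_pos less_imp_le)
  \<comment> \<open>The difference of squared norms factors into a difference of order
    \<open>1 / T\<close> and this sum, bounded because both sequences converge.\<close>
  have "(\<lambda>N. norm (s N) + norm (sstar N)) \<in> O(\<lambda>N. 1)"
    using tendsto_add[OF tendsto_norm[OF s_tendsto] tendsto_norm[OF sstar_tendsto]]
    by (intro bigoI_tendsto[where c = "norm sbar + norm sbar"]) simp_all
  then have prod: "(\<lambda>N. norm (s N - sstar N) * (norm (s N) + norm (sstar N))) \<in> O(\<lambda>N. 1 / T N * 1)"
    by (rule landau_o.big.mult[OF diff])
  have "(\<lambda>N. (norm (s N))\<^sup>2 - (norm (sstar N))\<^sup>2) \<in> O(\<lambda>N. norm (s N - sstar N) * (norm (s N) + norm (sstar N)))"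
  proof (intro bigoI[where c = 1] always_eventually allI)
    fix N
    have "(norm (s N))\<^sup>2 - (norm (sstar N))\<^sup>2 = (norm (s N) - norm (sstar N)) * (norm (s N) + norm (sstar N))"
      by (simp add: power2_eq_square algebra_simps)
    then show "norm ((norm (s N))\<^sup>2 - (norm (sstar N))\<^sup>2)
        \<le> 1 * norm (norm (s N - sstar N) * (norm (s N) + norm (sstar N)))"
      by (simp add: abs_mult mult_right_mono norm_triangle_ineq3)
  qed
  then have "(\<lambda>N. (norm (s N))\<^sup>2 - (norm (sstar N))\<^sup>2) \<in> O(\<lambda>N. 1 / T N)"
    using prod landau_o.big_trans by auto
  from sum_in_bigo(1)[OF this a]
  show "(\<lambda>N. (norm (s N))\<^sup>2 - (norm sbar)\<^sup>2) \<in> O(\<lambda>N. 1 / T N)" by simp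
  have "\<forall>\<^sub>F n in sequentially. norm (s (Suc n) - sbar) \<le> (c + sqrt C) * (1 / sqrt (T (Suc n)))"
    using c(2) T1
  proof eventually_elim
    case (elim n)
    \<comment> \<open>Once \<open>T (Suc n) \<ge> 1\<close>, the faster rate \<open>c / T\<close> of
      \<open>s - sstar\<close> is dominated by the square-root rate.\<close>
    have "sqrt (T (Suc n)) \<le> T (Suc n)" using elim(2) by (intro real_le_lsqrt) (auto simp: power2_eq_square)
    then have "c / T (Suc n) \<le> c * (1 / sqrt (T (Suc n)))"
      using c(1) T_Suc_pos[of n] by (simp add: frac_le)
    then show ?case
      using norm_triangle_ineq[of "s (Suc n) - sstar (Suc n)" "sstar (Suc n) - sbar"] elim(1) dist_sbar[of n]
      unfolding distrib_right by simp
  qed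
  then show "(\<lambda>N. norm (s N - sbar)) \<in> O(\<lambda>N. 1 / sqrt (T N))"
    using T_Suc_pos by (intro bigo_shift[where c = "c + sqrt C"]) (simp add: less_imp_le)
qed

end

theorem proposition2p2:
  fixes h :: "'a::{real_inner, complete_space} \<Rightarrow> ereal"
    and \<gamma> \<epsilon> :: "nat \<Rightarrow> real"
    and lstar sstar l s :: "nat \<Rightarrow> 'a"
    and sbar :: 'a
  assumes "closed_fun h" and "proper_fun h" and "convex_fun h"
    and "error_step_conditions \<gamma> \<epsilon>"
    and "ippa h \<gamma> \<epsilon> lstar sstar l s"
    and "sbar = min_norm_subgradient h"
  shows "sstar \<longlonglongrightarrow> sbar \<and> s \<longlonglongrightarrow> sbar \<and>
    (convex_conjugate h sbar < \<infinity> \<longrightarrow>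
      (\<lambda>N. (norm (sstar N))\<^sup>2 - (norm sbar)\<^sup>2) \<in> O(\<lambda>N. 1 / (\<Sum>i<N. \<gamma> i)) \<and>
      (\<lambda>N. (norm (s N))\<^sup>2 - (norm sbar)\<^sup>2) \<in> O(\<lambda>N. 1 / (\<Sum>i<N. \<gamma> i)) \<and>
      (\<lambda>N. norm (sstar N - sbar)) \<in> O(\<lambda>N. 1 / sqrt (\<Sum>i<N. \<gamma> i)) \<and>
      (\<lambda>N. norm (s N - sbar)) \<in> O(\<lambda>N. 1 / sqrt (\<Sum>i<N. \<gamma> i)))"
proof -
  interpret inexact_prox_iteration h \<gamma> \<epsilon> lstar sstar l s
    by unfold_locales (fact assms)+
  show ?thesis
    using sstar_tendsto s_tendsto rates unfolding assms(6) T_def by blast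
qed

end
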